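(* Let $m>2$, let $\mathcal{A}\in\mathbb{T}_{m,n}$ be a nonsingular $\mathcal{M}$-tensor, let $b\in\mathbb{R}^n_+$ and $F(x)=\mathcal{A}x^{m-1}-b$. Let $x^*$ be the limit point of an (infinite) sequence $\{x^k\}$ generated by Algorithm NPA (described in the context). Then $x^*$ is a solution of $F(x)=0$.
   Context: Notation. $[n]=\{1,\dots,n\}$; $\mathbb{R}^n_+$ is the set of entrywise nonnegative vectors; inequalities between vectors are entrywise. $\mathbb{T}_{m,n}$ is the set of real $m$-th order $n$-dimensional tensors $\mathcal{A}=(a_{i_1\cdots i_m})$, $1\le i_1,\dots,i_m\le n$. For $x\in\mathbb{R}^n$, $(\mathcal{A}x^{m-1})_i=\sum_{i_2,\dots,i_m=1}^n a_{ii_2\cdots i_m}x_{i_2}\cdots x_{i_m}$. A number $\lambda\in\mathbb{R}$ is an eigenvalue of $\mathcal{A}$ if there is $x\in\mathbb{R}^n\setminus\{0\}$ with $(\mathcal{A}x^{m-1})_i=\lambda x_i^{m-1}$ for all $i$; $\rho(\mathcal{A})$ is the maximum modulus of the eigenvalues. $\mathcal{I}$ is the identity tensor (entries $1$ if all indices are equal, $0$ otherwise). $\mathcal{A}$ is a nonsingular $\mathcal{M}$-tensor if $\mathcal{A}=s\mathcal{I}-\mathcal{B}$ with $\mathcal{B}$ entrywise nonnegative and $s>\rho(\mathcal{B})$. $F'(x)$ is the Jacobian of $F$ at $x$; for $\theta\subseteq[n]$, $x_\theta$ is the sub-vector and $A_{\theta\theta}$ the principal sub-matrix indexed by $\theta$.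 "The limit point" of $\{x^k\}$ means its limit as $k\to\infty$ (the sequence generated by the algorithm is entrywise decreasing and bounded below by $0$, hence convergent). Algorithm NPA. Choose $\delta_1,\delta_2\in(0,1)$ and a starting point $x^0\in\mathbb{R}^n_+$ with $F(x^0)\ge 0$. For $k=0,1,2,\dots$, while $F(x^k)\neq 0$, perform the following iteration: (1) Let $j\in[n]$ (depending on $k$) satisfy $F_j(x^k)=\max_{i\in[n]}F_i(x^k)$; let $I_k=\{i\in[n]:F_i(x^k)>0\}\setminus\{j\}$ and $\bar I_k=\{\ell\in[n]:F_\ell(x^k)=0\}$. (2) Set $x^{k+1}_{\bar I_k}=x^k_{\bar I_k}$. (3) Let $\bar d^k_j=-x^k_j$. For $p=0,1,2,\dots$ compute $F_j(x^k_1,\dots,x^k_{j-1},x^k_j+\delta_1^p\bar d^k_j,x^k_{j+1},\dots,x^k_n)$; at the first $p$ for which this is $\ge 0$, set $x^{k+1}_j=x^k_j+\delta_1^p\bar d^k_j$ and stop this loop. (4) Let $d^k\in\mathbb{R}^n$ with $d^k_{\bar I_k}=0$, $d^k_j=0$ and $d^k_{I_k}=-\big([F'(x^k)]_{I_kI_k}\big)^{-1}[F(x^k)]_{I_k}$. For $q=0,1,2,\dots$ compute $F_{I_k}(x^k+\delta_2^q d^k)$; at the first $q$ for which this vector is $\ge 0$, set $x^{k+1}_{I_k}=x^k_{I_k}+\delta_2^q d^k_{I_k}$ and stop this loop. (If $I_k=\emptyset$, this step is void.) *)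

theory Defs
  imports "HOL-Analysis.Analysis"
begin

text \<open>
  A real tensor of order m and dimension CARD('n) is given by its entries, indexed by lists of
  indices; only the entries at lists of length m matter, so the order m is passed explicitly
  wherever it is relevant.
\<close>

type_synonym 'n tensor = "'n list \<Rightarrow> real"

text \<open>The vector written A x^(m-1) in the literature.\<close>

definition tensor_app :: "nat \<Rightarrow> 'n tensor \<Rightarrow> real ^ 'n \<Rightarrow> real ^ 'n::finite" where
  "tensor_app m A x =
     (\<chi> i. \<Sum>is\<in>{is. length is = m - 1}. A (i # is) * (\<Prod>l\<leftarrow>is. x $ l))"

definition is_eigenvalue :: "nat \<Rightarrow> 'n::finite tensor \<Rightarrow> real \<Rightarrow> bool" where
  "is_eigenvalue m A ev \<longleftrightarrow>
     (\<exists>x :: real ^ 'n. x \<noteq> 0 \<and> (\<forall>i. tensor_app m A x $ i = ev * (x $ i) ^ (m - 1)))"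

text \<open>
  The set of eigenvalues is compact, so the supremum is the maximum modulus
  whenever an eigenvalue exists; for nonnegative tensors one always does.
\<close>

definition spectral_rad :: "nat \<Rightarrow> 'n::finite tensor \<Rightarrow> real" where
  "spectral_rad m A = Sup {\<bar>ev\<bar> |ev. is_eigenvalue m A ev}"

definition id_tensor :: "'n tensor" where
  "id_tensor is = (if \<forall>p\<in>set is. \<forall>q\<in>set is. p = q then 1 else 0)"

definition nonsingular_M_tensor :: "nat \<Rightarrow> 'n::finite tensor \<Rightarrow> bool" where
  "nonsingular_M_tensor m A \<longleftrightarrow>
     (\<exists>s B. (\<forall>is. length is = m \<longrightarrow> B is \<ge> 0)
          \<and> s > spectral_rad m B
          \<and> (\<forall>is. length is = m \<longrightarrow> A is = s * id_tensor is - B is))"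

text \<open>
  N is the (two-sided) inverse of the principal submatrix of M with rows and columns in T; the
  entries of N outside of T are irrelevant.
\<close>

definition principal_inverse ::
  "'n set \<Rightarrow> real ^ 'n ^ 'n \<Rightarrow> real ^ 'n ^ 'n::finite \<Rightarrow> bool" where
  "principal_inverse T M N \<longleftrightarrow>
     (\<forall>i\<in>T. \<forall>l\<in>T. (\<Sum>k\<in>T. M $ i $ k * N $ k $ l) = (if i = l then 1 else 0)
                \<and> (\<Sum>k\<in>T. N $ i $ k * M $ k $ l) = (if i = l then 1 else 0))"

text \<open>The point at which the line search for the coordinate j evaluates F.\<close>

definition move_coord :: "'n \<Rightarrow> real \<Rightarrow> real ^ 'n \<Rightarrow> real ^ 'n::finite" where
  "move_coord j t x = (\<chi> i. if i = j then x $ j + t * (- x $ j) else x $ i)"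

text \<open>
  One iteration of Algorithm NPA from x to y. It is a relation because the choice of j among the
  maximizing indices is free; it holds only if the principal submatrix of the Jacobian is
  invertible and both line searches terminate, i.e. if the iteration can be carried out.
\<close>

definition NPA_step ::
  "(real ^ 'n \<Rightarrow> real ^ 'n) \<Rightarrow> real \<Rightarrow> real \<Rightarrow> real ^ 'n \<Rightarrow> real ^ 'n::finite \<Rightarrow> bool" where
  "NPA_step F \<delta>1 \<delta>2 x y \<longleftrightarrow>
     (\<exists>j. F x $ j = Max (range (\<lambda>i. F x $ i)) \<and>
       (let I = {i. F x $ i > 0} - {j};
            Ibar = {l. F x $ l = 0}
        in (\<forall>l\<in>Ibar. y $ l = x $ l)
         \<and> (\<exists>p::nat. F (move_coord j (\<delta>1 ^ p) x) $ j \<ge> 0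
              \<and> (\<forall>p'<p. \<not> F (move_coord j (\<delta>1 ^ p') x) $ j \<ge> 0)
              \<and> y $ j = x $ j + \<delta>1 ^ p * (- x $ j))
         \<and> (\<exists>d N. (\<forall>l\<in>Ibar. d $ l = 0) \<and> d $ j = 0
              \<and> principal_inverse I (jacobian F (at x)) N
              \<and> (\<forall>i\<in>I. d $ i = - (\<Sum>l\<in>I. N $ i $ l * F x $ l))
              \<and> (\<exists>q::nat. (\<forall>i\<in>I. F (x + \<delta>2 ^ q *\<^sub>R d) $ i \<ge> 0)
                   \<and> (\<forall>q'<q. \<not> (\<forall>i\<in>I. F (x + \<delta>2 ^ q' *\<^sub>R d) $ i \<ge> 0))
                   \<and> (\<forall>i\<in>I. y $ i = x $ i + \<delta>2 ^ q * d $ i)))))"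

text \<open>
  An infinite run of the algorithm: the stopping test F (X k) = 0 never succeeds. On vectors, the
  order is the componentwise one.
\<close>

definition NPA_sequence ::
  "(real ^ 'n \<Rightarrow> real ^ 'n) \<Rightarrow> real \<Rightarrow> real \<Rightarrow> (nat \<Rightarrow> real ^ 'n::finite) \<Rightarrow> bool" where
  "NPA_sequence F \<delta>1 \<delta>2 X \<longleftrightarrow>
     0 < \<delta>1 \<and> \<delta>1 < 1 \<and> 0 < \<delta>2 \<and> \<delta>2 < 1 \<and>
     0 \<le> X 0 \<and> 0 \<le> F (X 0) \<and>
     (\<forall>k. F (X k) \<noteq> 0 \<and> NPA_step F \<delta>1 \<delta>2 (X k) (X (Suc k)))"

end

theory Submission
  imports Defs
begin

text \<open>
  Off-diagonal entries of an M-tensor are nonpositive, so on the nonnegative orthant each component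
  \<open>F\<^sub>i\<close> is antitone in the variables other than \<open>x\<^sub>i\<close>, and \<open>F'(x)\<close> is a Z-matrix. By Euler's
  identity, \<open>F'(x) x = (m - 1) (F(x) + b)\<close>, which is positive on \<open>I\<close> and dominates \<open>F(x)\<close> there. The
  first makes \<open>F'(x)\<^sub>I\<^sub>I\<close> inverse-nonnegative, the second then bounds the Newton direction from below,
  so that \<open>-x \<le> d \<le> 0\<close> on \<open>I\<close>. Hence \<open>0 \<le> x\<close> and \<open>0 \<le> F(x)\<close> hold for all iterates.

  If \<open>F(x\<^sup>*) \<noteq> 0\<close>, some index \<open>j\<close> is chosen infinitely often, and \<open>F\<^sub>j(x\<^sup>*)\<close> is the maximum, so it is
  positive; this forces \<open>x\<^sup>*\<^sub>j > 0\<close>. By continuity the line search for \<open>j\<close> stops after boundedly many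
  trials, so infinitely often \<open>x\<^sub>j\<close> shrinks by a fixed factor below 1, contradicting
  \<open>x\<^sup>*\<^sub>j > 0\<close>.
\<close>

section \<open>Z-matrices and derivatives along lines\<close>

text \<open>Row \<open>i\<close> of a Z-matrix is nonpositive on any nonnegative vector vanishing at
  \<open>i\<close>, so \<open>u\<close> is in fact positive. If \<open>v\<close> had a negative
  entry, the least ratio \<open>t\<close> of \<open>v\<close> to \<open>u\<close> would be negative
  and \<open>v - t * u\<close> would be nonnegative with a zero at the minimizer \<open>l\<close>;
  but row \<open>l\<close> of its image is at least \<open>- t\<close> times a positive
  number.\<close>

lemma Z_matrix_monotone:
  fixes M :: "'i \<Rightarrow> 'i \<Rightarrow> real"
  assumes fin: "finite I"
    and Z: "\<And>i k. \<lbrakk>i \<in> I; k \<in> I; i \<noteq> k\<rbrakk> \<Longrightarrow> M i k \<le> 0"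
    and u: "\<And>i. i \<in> I \<Longrightarrow> 0 \<le> u i"
    and Mu: "\<And>i. i \<in> I \<Longrightarrow> 0 < (\<Sum>k\<in>I. M i k * u k)"
    and Mv: "\<And>i. i \<in> I \<Longrightarrow> 0 \<le> (\<Sum>k\<in>I. M i k * v k)"
    and i: "i \<in> I"
  shows "0 \<le> v i"
proof (rule ccontr)
  have row: "(\<Sum>k\<in>I. M i k * w k) \<le> 0"
    if "i \<in> I" "w i = 0" "\<And>k. k \<in> I \<Longrightarrow> 0 \<le> w k" for i and w :: "'i \<Rightarrow> real"
    using that Z by (intro sum_nonpos) (metis mult_nonpos_nonneg mult_zero_right)
  have upos: "0 < u k" if "k \<in> I" for k
    using row[of k u] Mu[of k] u that by (metis less_le_not_le order_le_less)
  assume neg: "\<not> 0 \<le> v i"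
  obtain l where l: "l \<in> I" and lmin: "\<And>k. k \<in> I \<Longrightarrow> v l / u l \<le> v k / u k"
    using ex_is_arg_min_if_finite[OF fin, of "\<lambda>k. v k / u k"] i
    unfolding is_arg_min_def by (metis empty_iff linorder_not_less)
  define t where "t = v l / u l"
  have "t < 0"
    using lmin[OF i] neg upos[OF i] unfolding t_def by (smt (verit) divide_neg_pos)
  have "(\<Sum>k\<in>I. M l k * (v k - t * u k)) \<le> 0"
  proof (rule row[OF l])
    show "v l - t * u l = 0"
      using upos[OF l] by (simp add: t_def)
    show "0 \<le> v k - t * u k" if "k \<in> I" for k
      using lmin[OF that] upos[OF that] by (simp add: t_def pos_le_divide_eq)
  qed
  moreover have "(\<Sum>k\<in>I. M l k * (v k - t * u k)) =
      (\<Sum>k\<in>I. M l k * v k) - t * (\<Sum>k\<in>I. M l k * u k)"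
    by (simp add: algebra_simps sum_subtractf sum_distrib_left)
  moreover have "t * (\<Sum>k\<in>I. M l k * u k) < 0"
    using \<open>t < 0\<close> Mu[OF l] by (rule mult_neg_pos)
  ultimately show False
    using Mv[OF l] by linarith
qed

text \<open>Applied along \<open>axis k 1\<close> this isolates one Jacobian entry; applied along
  the ray from 0 through \<open>x\<close> it yields Euler's identity.\<close>

lemma has_real_derivative_line:
  fixes F :: "real ^ 'n::finite \<Rightarrow> real ^ 'm::finite"
  assumes "F differentiable (at (x + t *\<^sub>R h))"
  shows "((\<lambda>t. F (x + t *\<^sub>R h) $ i) has_real_derivative
           (jacobian F (at (x + t *\<^sub>R h)) *v h) $ i) (at t)"
proof -
  let ?J = "jacobian F (at (x + t *\<^sub>R h))"
  have F: "(F has_derivative (\<lambda>h. ?J *v h)) (at (x + t *\<^sub>R h))"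
    using assms by (simp add: jacobian_works)
  have "((\<lambda>t. x + t *\<^sub>R h) has_derivative (\<lambda>s. s *\<^sub>R h)) (at t)"
    by (auto intro!: derivative_eq_intros)
  from has_derivative_compose[OF this F]
  have "((\<lambda>t. F (x + t *\<^sub>R h) $ i) has_derivative (\<lambda>s. (?J *v (s *\<^sub>R h)) $ i)) (at t)"
    by (rule bounded_linear.has_derivative[OF bounded_linear_vec_nth])
  moreover have "(\<lambda>s. (?J *v (s *\<^sub>R h)) $ i) = (*) ((?J *v h) $ i)"
    by (auto simp: matrix_vector_mult_scaleR)
  ultimately show ?thesis
    by (simp add: has_field_derivative_def)
qed

section \<open>Convergence of the algorithm for an abstract map\<close>

text \<open>These are the analytic properties through which the tensor enters the convergence
  argument. \<open>Euler_ge\<close> is Euler's identity weakened to an inequality, so that neither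
  the degree nor \<open>b\<close> appears.\<close>

locale Z_map =
  fixes F :: "real ^ 'n::finite \<Rightarrow> real ^ 'n"
  assumes antitone: "\<lbrakk>0 \<le> y; y \<le> x; y $ i = x $ i\<rbrakk> \<Longrightarrow> F x $ i \<le> F y $ i"
    and differentiable: "F differentiable (at x)"
    and Euler_ge: "\<lbrakk>0 \<le> x; 0 \<le> F x $ i\<rbrakk> \<Longrightarrow> F x $ i \<le> (jacobian F (at x) *v x) $ i"
    and at_zero: "F 0 \<le> 0"
begin

lemma jacobian_offdiag_nonpos:
  assumes "0 \<le> x" "i \<noteq> k"
  shows "jacobian F (at x) $ i $ k \<le> 0"
proof (rule ccontr)
  let ?f = "\<lambda>t. F (x + t *\<^sub>R axis k 1) $ i"
  assume "\<not> jacobian F (at x) $ i $ k \<le> 0"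
  moreover have "(?f has_real_derivative jacobian F (at x) $ i $ k) (at 0)"
    using has_real_derivative_line[of F x 0 "axis k 1" i] differentiable
    by (simp add: matrix_vector_mul_component inner_axis)
  ultimately obtain e where "0 < e" and e: "\<And>h. \<lbrakk>0 < h; h < e\<rbrakk> \<Longrightarrow> ?f 0 < ?f (0 + h)"
    using DERIV_pos_inc_right[of ?f "jacobian F (at x) $ i $ k" 0] by auto
  have "?f (e / 2) \<le> F x $ i"
    using assms \<open>0 < e\<close> by (intro antitone) (auto simp: less_eq_vec_def axis_def)
  with e[of "e / 2"] \<open>0 < e\<close> show False by simp
qed

lemma move_coord_bounds:
  assumes "0 \<le> x" "0 \<le> t" "t \<le> 1"
  shows "0 \<le> move_coord j t x" "move_coord j t x \<le> x"
  using assms by (auto simp: move_coord_def less_eq_vec_def mult_left_le_one_le)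

lemma Newton_direction_bounds:
  assumes x: "0 \<le> x"
    and I: "\<And>i. i \<in> I \<Longrightarrow> 0 < F x $ i"
    and inv: "principal_inverse I (jacobian F (at x)) N"
    and d: "\<And>i. i \<in> I \<Longrightarrow> d $ i = - (\<Sum>l\<in>I. N $ i $ l * F x $ l)"
    and i: "i \<in> I"
  shows "- x $ i \<le> d $ i" "d $ i \<le> 0"
proof -
  let ?J = "\<lambda>i k. jacobian F (at x) $ i $ k"
  have Jd: "(\<Sum>k\<in>I. ?J i k * d $ k) = - F x $ i" if i: "i \<in> I" for i
  proof -
    have "(\<Sum>k\<in>I. ?J i k * d $ k) = - (\<Sum>k\<in>I. \<Sum>l\<in>I. ?J i k * N $ k $ l * F x $ l)"
      by (simp add: d sum_distrib_left sum_negf mult.assoc)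
    also have "\<dots> = - (\<Sum>l\<in>I. (\<Sum>k\<in>I. ?J i k * N $ k $ l) * F x $ l)"
      by (subst sum.swap) (simp add: sum_distrib_right)
    also have "\<dots> = - (\<Sum>l\<in>I. (if i = l then F x $ l else 0))"
      using inv i unfolding principal_inverse_def
      by (intro arg_cong[where f = uminus] sum.cong) auto
    finally show ?thesis using i by simp
  qed
  \<comment> \<open>Columns outside \<open>I\<close> are off-diagonal for row \<open>i\<close> and
    contribute nonpositive terms, so dropping them keeps the lower bound.\<close>
  have Jx: "F x $ i \<le> (\<Sum>k\<in>I. ?J i k * x $ k)" if i: "i \<in> I" for i
  proof -
    have "(\<Sum>k\<in>-I. ?J i k * x $ k) \<le> 0"
      using x i by (intro sum_nonpos mult_nonpos_nonneg jacobian_offdiag_nonpos)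
        (auto simp: less_eq_vec_def)
    moreover have "(jacobian F (at x) *v x) $ i
        = (\<Sum>k\<in>I. ?J i k * x $ k) + (\<Sum>k\<in>-I. ?J i k * x $ k)"
      by (simp add: matrix_vector_mult_def Compl_eq_Diff_UNIV sum.subset_diff[of I UNIV])
    ultimately show ?thesis
      using Euler_ge[OF x, of i] I[OF i] by linarith
  qed
  \<comment> \<open>The iterate \<open>x\<close> is the positivity witness. The fact is applied to
    \<open>- d\<close> and \<open>x + d\<close>, whose images under the submatrix are
    \<open>F x\<close> and the image of \<open>x\<close> minus \<open>F x\<close>.\<close>
  have nonneg: "0 \<le> v i" if "\<And>i. i \<in> I \<Longrightarrow> 0 \<le> (\<Sum>k\<in>I. ?J i k * v k)" for v
  proof (rule Z_matrix_monotone[where I = I and u = "($) x" and M = ?J])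
    show "0 < (\<Sum>k\<in>I. ?J i k * x $ k)" if "i \<in> I" for i
      using Jx[OF that] I[OF that] by linarith
  qed (use x i that jacobian_offdiag_nonpos in \<open>auto simp: less_eq_vec_def\<close>)
  have "0 \<le> - d $ i"
    by (rule nonneg[of "\<lambda>i. - d $ i"]) (simp add: sum_negf Jd I less_imp_le)
  then show "d $ i \<le> 0" by simp
  have "0 \<le> x $ i + d $ i"
    by (rule nonneg[of "\<lambda>i. x $ i + d $ i"]) (simp add: distrib_left sum.distrib Jd Jx)
  then show "- x $ i \<le> d $ i" by simp
qed

text \<open>Neither line search evaluates \<open>F\<close> at \<open>y\<close> itself. But
  \<open>y\<close> lies below each tested point, agrees with \<open>move_coord j ?s x\<close> at
  \<open>j\<close>, with \<open>z\<close> on \<open>I\<close> and with \<open>x\<close> on the zero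
  set of \<open>F x\<close>, so \<open>antitone\<close> carries the nonnegativity of each component
  over to \<open>y\<close>.\<close>

lemma NPA_step_feasible:
  assumes step: "NPA_step F \<delta>1 \<delta>2 x y"
    and \<delta>: "0 < \<delta>1" "\<delta>1 < 1" "0 < \<delta>2" "\<delta>2 < 1"
    and x: "0 \<le> x" and Fx: "0 \<le> F x" "F x \<noteq> 0"
  shows "0 \<le> y" "0 \<le> F y"
proof -
  obtain j p d N q where j: "F x $ j = Max (range (\<lambda>i. F x $ i))"
    and yIbar: "\<forall>l\<in>{l. F x $ l = 0}. y $ l = x $ l"
    and p: "0 \<le> F (move_coord j (\<delta>1 ^ p) x) $ j"
    and yj: "y $ j = x $ j + \<delta>1 ^ p * (- x $ j)"
    and dIbar: "\<forall>l\<in>{l. F x $ l = 0}. d $ l = 0" and dj: "d $ j = 0"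
    and N: "principal_inverse ({i. F x $ i > 0} - {j}) (jacobian F (at x)) N"
    and dI: "\<forall>i\<in>{i. F x $ i > 0} - {j}.
          d $ i = - (\<Sum>l\<in>{i. F x $ i > 0} - {j}. N $ i $ l * F x $ l)"
    and q: "\<forall>i\<in>{i. F x $ i > 0} - {j}. 0 \<le> F (x + \<delta>2 ^ q *\<^sub>R d) $ i"
    and yI: "\<forall>i\<in>{i. F x $ i > 0} - {j}. y $ i = x $ i + \<delta>2 ^ q * d $ i"
    using step unfolding NPA_step_def Let_def by (elim exE conjE) (rule that; assumption)
  define I where "I = {i. F x $ i > 0} - {j}"
  have cases: "i = j \<or> F x $ i = 0 \<or> i \<in> I" for i
    using Fx(1) by (auto simp: I_def less_eq_vec_def order_less_le)
  obtain i0 where "F x $ i0 \<noteq> 0"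
    using Fx(2) by (auto simp: vec_eq_iff)
  then have "0 < F x $ i0"
    using Fx(1) by (simp add: less_eq_vec_def order_less_le)
  moreover have "F x $ i0 \<le> F x $ j"
    unfolding j by (intro Max_ge) auto
  ultimately have Fj: "0 < F x $ j" by linarith
  have d: "- x $ i \<le> d $ i" "d $ i \<le> 0" if "i \<in> I" for i
    using Newton_direction_bounds[OF x _ N, of d i] dI that by (auto simp: I_def)
  have d_bounds: "- x $ i \<le> d $ i" "d $ i \<le> 0" for i
    using cases[of i] d[of i] dIbar dj x by (auto simp: less_eq_vec_def)
  let ?s = "\<delta>1 ^ p" and ?t = "\<delta>2 ^ q"
  have s: "0 \<le> ?s" "?s \<le> 1" and t: "0 \<le> ?t" "?t \<le> 1"
    using \<delta> by (auto simp: power_le_one)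
  define z where "z = x + ?t *\<^sub>R d"
  have z: "0 \<le> z" "z \<le> x"
  proof -
    have "0 \<le> z $ i \<and> z $ i \<le> x $ i" for i
    proof -
      have "d $ i \<le> ?t * d $ i" "?t * d $ i \<le> 0"
        using mult_right_mono_neg[OF t(2) d_bounds(2)[of i]] mult_nonneg_nonpos[OF t(1) d_bounds(2)]
        by simp_all
      with d_bounds(1)[of i] show ?thesis by (simp add: z_def)
    qed
    then show "0 \<le> z" "z \<le> x" by (auto simp: less_eq_vec_def)
  qed
  note w = move_coord_bounds[OF x s, of j]
  have y: "y $ i = (if i = j then move_coord j ?s x $ i else z $ i)" for i
    using cases[of i] yj yIbar dIbar yI
    by (auto simp: move_coord_def z_def I_def)
  show y0: "0 \<le> y"
    using w(1) z(1) by (simp add: less_eq_vec_def y)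
  have zj: "z $ j = x $ j"
    by (simp add: z_def dj)
  have yz: "y \<le> z"
    using w(2) zj by (auto simp: less_eq_vec_def y)
  have yw: "y \<le> move_coord j ?s x"
    using z(2) by (auto simp: less_eq_vec_def y move_coord_def)
  have "0 \<le> F y $ i" for i
  proof -
    consider "i = j" | "F x $ i = 0" "i \<noteq> j" | "i \<in> I" "i \<noteq> j"
      using cases[of i] Fj by blast
    then show ?thesis
    proof cases
      case 1
      have "F (move_coord j ?s x) $ j \<le> F y $ j"
        using y0 yw by (rule antitone) (simp add: y)
      with p 1 show ?thesis by simp
    next
      case 2
      have "F x $ i \<le> F y $ i"
        using y0 order_trans[OF yz z(2)] by (rule antitone) (simp add: 2 yIbar)
      with 2 show ?thesis by simp
    next
      case 3
      have "F z $ i \<le> F y $ i"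
        using y0 yz by (rule antitone) (simp add: y 3)
      moreover have "0 \<le> F z $ i"
        using q 3 unfolding z_def I_def by blast
      ultimately show ?thesis by linarith
    qed
  qed
  then show "0 \<le> F y" by (simp add: less_eq_vec_def)
qed

lemma NPA_sequence_feasible:
  assumes "NPA_sequence F \<delta>1 \<delta>2 X"
  shows "0 \<le> X k \<and> 0 \<le> F (X k)"
proof (induction k)
  case 0
  with assms show ?case by (simp add: NPA_sequence_def)
next
  case (Suc k)
  with assms show ?case
    using NPA_step_feasible[of \<delta>1 \<delta>2 "X k" "X (Suc k)"] by (auto simp: NPA_sequence_def)
qed

lemma NPA_sequence_limit:
  assumes seq: "NPA_sequence F \<delta>1 \<delta>2 X" and lim: "X \<longlonglongrightarrow> l"
  shows "F l = 0"
proof (rule ccontr)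
  assume "F l \<noteq> 0"
  have cont: "isCont F x" for x
    using differentiable by (rule differentiable_imp_continuous_within)
  have nonneg: "0 \<le> l $ i" "0 \<le> F l $ i" for i
  proof -
    have "(\<lambda>k. X k $ i) \<longlonglongrightarrow> l $ i" "(\<lambda>k. F (X k) $ i) \<longlonglongrightarrow> F l $ i"
      using lim isCont_tendsto_compose[OF cont lim] by (auto intro: tendsto_vec_nth)
    then show "0 \<le> l $ i" "0 \<le> F l $ i"
      using NPA_sequence_feasible[OF seq]
      by (auto intro!: LIMSEQ_le_const simp: less_eq_vec_def)
  qed
  have "\<exists>j p. (\<forall>i. F (X k) $ i \<le> F (X k) $ j)
      \<and> (\<forall>p'<p. \<not> 0 \<le> F (move_coord j (\<delta>1 ^ p') (X k)) $ j)
      \<and> X (Suc k) $ j = X k $ j + \<delta>1 ^ p * (- X k $ j)" for k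
  proof -
    have "NPA_step F \<delta>1 \<delta>2 (X k) (X (Suc k))"
      using seq by (simp add: NPA_sequence_def)
    then obtain j p where "F (X k) $ j = Max (range (\<lambda>i. F (X k) $ i))"
      and "\<forall>p'<p. \<not> 0 \<le> F (move_coord j (\<delta>1 ^ p') (X k)) $ j"
      and "X (Suc k) $ j = X k $ j + \<delta>1 ^ p * (- X k $ j)"
      unfolding NPA_step_def Let_def by blast
    moreover from this(1) have "F (X k) $ i \<le> F (X k) $ j" for i
      by simp
    ultimately show ?thesis by blast
  qed
  then obtain J P where max: "\<And>k i. F (X k) $ i \<le> F (X k) $ J k"
    and search: "\<And>k p'. p' < P k \<Longrightarrow> \<not> 0 \<le> F (move_coord (J k) (\<delta>1 ^ p') (X k)) $ J k"
    and upd: "\<And>k. X (Suc k) $ J k = X k $ J k + \<delta>1 ^ P k * (- X k $ J k)"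
    by metis
  obtain j where "infinite {k. J k = j}"
    using pigeonhole_infinite[of "UNIV :: nat set" J] by auto
  then obtain r :: "nat \<Rightarrow> nat" where r: "strict_mono r" and Jr: "\<And>k. J (r k) = j"
    using infinite_enumerate[of "{k. J k = j}"] by auto
  have Xr: "(\<lambda>k. X (r k)) \<longlonglongrightarrow> l"
    using LIMSEQ_subseq_LIMSEQ[OF lim r] by (simp add: o_def)
  \<comment> \<open>Convergence of the whole sequence gives the successors of the chosen iterates
    the same limit.\<close>
  have Xr': "(\<lambda>k. X (Suc (r k))) \<longlonglongrightarrow> l"
    using LIMSEQ_subseq_LIMSEQ[OF LIMSEQ_Suc[OF lim] r] by (simp add: o_def)
  have FXr: "(\<lambda>k. F (X (r k)) $ i) \<longlonglongrightarrow> F l $ i" for i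
    by (intro tendsto_vec_nth isCont_tendsto_compose[OF cont] Xr)
  have maxl: "F l $ i \<le> F l $ j" for i
    using LIMSEQ_le[OF FXr FXr, of i j] max Jr by (metis)
  obtain i where "F l $ i \<noteq> 0"
    using \<open>F l \<noteq> 0\<close> by (auto simp: vec_eq_iff)
  then have Fj: "0 < F l $ j"
    using nonneg(2)[of i] maxl[of i] by linarith
  \<comment> \<open>If \<open>l $ j\<close> were 0, then \<open>l\<close> and 0 would agree at
    \<open>j\<close>, and \<open>antitone\<close> would bound \<open>F l $ j\<close> by
    \<open>F 0 $ j\<close>.\<close>
  have lj: "0 < l $ j"
  proof (rule ccontr)
    assume "\<not> 0 < l $ j"
    then have "F l $ j \<le> F 0 $ j"
      using nonneg(1) by (intro antitone) (auto simp: less_eq_vec_def intro: antisym)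
    with Fj at_zero show False
      by (auto simp: less_eq_vec_def) (smt (verit))
  qed
  have \<delta>1: "0 < \<delta>1" "\<delta>1 < 1"
    using seq by (auto simp: NPA_sequence_def)
  \<comment> \<open>This form makes continuity in both the step length and the base point
    visible.\<close>
  have move_eq: "move_coord j t x = x - (t * x $ j) *\<^sub>R axis j 1" for t and x :: "real ^ 'n"
    by (auto simp: vec_eq_iff move_coord_def axis_def)
  have "(\<lambda>p. l - (\<delta>1 ^ p * l $ j) *\<^sub>R axis j 1) \<longlonglongrightarrow> l - (0 * l $ j) *\<^sub>R axis j 1"
    using \<delta>1 by (intro tendsto_intros LIMSEQ_realpow_zero) auto
  then have "(\<lambda>p. move_coord j (\<delta>1 ^ p) l) \<longlonglongrightarrow> l"
    by (simp add: move_eq)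
  then have "(\<lambda>p. F (move_coord j (\<delta>1 ^ p) l) $ j) \<longlonglongrightarrow> F l $ j"
    by (intro tendsto_vec_nth isCont_tendsto_compose[OF cont])
  \<comment> \<open>Strict positivity at the limit persists at \<open>X (r k)\<close> for large
    \<open>k\<close>, so trial \<open>p\<close> succeeds there and the accepted exponent is at most
    \<open>p\<close>.\<close>
  then obtain p where p: "0 < F (move_coord j (\<delta>1 ^ p) l) $ j"
    using order_tendstoD(1)[OF _ Fj] eventually_happens'[OF sequentially_bot] by blast
  have "(\<lambda>k. move_coord j (\<delta>1 ^ p) (X (r k))) \<longlonglongrightarrow> move_coord j (\<delta>1 ^ p) l"
    unfolding move_eq by (intro tendsto_intros Xr)
  then have "(\<lambda>k. F (move_coord j (\<delta>1 ^ p) (X (r k))) $ j) \<longlonglongrightarrow> F (move_coord j (\<delta>1 ^ p) l) $ j"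
    by (intro tendsto_vec_nth isCont_tendsto_compose[OF cont])
  from order_tendstoD(1)[OF this p]
  have "\<forall>\<^sub>F k in sequentially. X (Suc (r k)) $ j \<le> X (r k) $ j - \<delta>1 ^ p * X (r k) $ j"
  proof eventually_elim
    case (elim k)
    then have "P (r k) \<le> p"
      using search[of p "r k"] Jr by force
    then have "\<delta>1 ^ p \<le> \<delta>1 ^ P (r k)"
      using \<delta>1 by (intro power_decreasing) auto
    moreover have "0 \<le> X (r k) $ j"
      using NPA_sequence_feasible[OF seq] by (simp add: less_eq_vec_def)
    ultimately have "\<delta>1 ^ p * X (r k) $ j \<le> \<delta>1 ^ P (r k) * X (r k) $ j"
      by (rule mult_right_mono)
    then show ?case
      using upd[of "r k"] Jr by simp
  qed
  moreover have "(\<lambda>k. X (Suc (r k)) $ j) \<longlonglongrightarrow> l $ j"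
    using Xr' by (rule tendsto_vec_nth)
  moreover have "(\<lambda>k. X (r k) $ j - \<delta>1 ^ p * X (r k) $ j) \<longlonglongrightarrow> l $ j - \<delta>1 ^ p * l $ j"
    by (intro tendsto_intros Xr)
  ultimately have "l $ j \<le> l $ j - \<delta>1 ^ p * l $ j"
    using tendsto_le[OF sequentially_bot] by blast
  then show False
    using lj zero_less_power[OF \<delta>1(1), of p] by (simp add: mult_le_0_iff)
qed

end

section \<open>Monotonicity, differentiability and homogeneity of the tensor map\<close>

lemma finite_index_lists: "finite {is :: 'n::finite list. length is = k}"
  using finite_lists_length_eq[of "UNIV :: 'n set" k] by simp

text \<open>Compare term by term: an off-diagonal entry multiplies a product that is monotone on the
  nonnegative orthant, and the diagonal term involves only the common coordinate
  \<open>i\<close>.\<close>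

lemma tensor_app_antitone:
  assumes offdiag: "\<And>is. \<lbrakk>length is = m; id_tensor is = 0\<rbrakk> \<Longrightarrow> A is \<le> 0"
    and m: "0 < m" and y: "0 \<le> y" "y \<le> x" "y $ i = x $ i"
  shows "tensor_app m A x $ i \<le> tensor_app m A y $ i"
  unfolding tensor_app_def vec_lambda_beta
proof (intro sum_mono)
  fix "is" :: "'a list"
  assume "is \<in> {is. length is = m - 1}"
  then have len: "length (i # is) = m"
    using m by simp
  show "A (i # is) * (\<Prod>l\<leftarrow>is. x $ l) \<le> A (i # is) * (\<Prod>l\<leftarrow>is. y $ l)"
  proof (cases "id_tensor (i # is) = 0")
    case True
    have "0 \<le> (\<Prod>l\<leftarrow>is. y $ l) \<and> (\<Prod>l\<leftarrow>is. y $ l) \<le> (\<Prod>l\<leftarrow>is. x $ l)" for "is"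
    proof (induction "is")
      case (Cons k ks)
      have "0 \<le> y $ k" "y $ k \<le> x $ k"
        using y by (auto simp: less_eq_vec_def)
      with Cons show ?case
        by (auto intro!: mult_mono)
    qed simp
    with offdiag[OF len True] show ?thesis
      by (intro mult_left_mono_neg) auto
  next
    case False
    then have "\<forall>l\<in>set is. l = i"
      by (auto simp: id_tensor_def split: if_splits)
    then have "map (($) x) is = map (($) y) is"
      using y(3) by (auto intro: map_cong)
    then show ?thesis by (simp only: order_refl)
  qed
qed

lemma tensor_app_scaleR:
  "tensor_app m A (c *\<^sub>R x) = c ^ (m - 1) *\<^sub>R tensor_app m A x"
proof -
  have "(\<Prod>l\<leftarrow>is. (c *\<^sub>R x) $ l) = c ^ length is * (\<Prod>l\<leftarrow>is. x $ l)" for "is"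
    by (induction "is") auto
  then show ?thesis
    by (auto simp: tensor_app_def vec_eq_iff sum_distrib_left intro!: sum.cong)
qed

lemma tensor_app_differentiable: "tensor_app m A differentiable (at x)"
proof -
  have prod: "(\<lambda>x :: real ^ 'a. \<Prod>l\<leftarrow>is. x $ l) differentiable (at x)" for "is"
  proof (induction "is")
    case (Cons k ks)
    have "(\<lambda>x :: real ^ 'a. x $ k) differentiable (at x)"
      by (rule bounded_linear_imp_differentiable[OF bounded_linear_vec_nth])
    with Cons show ?case by simp
  qed simp
  have "(\<lambda>x. tensor_app m A x $ i) differentiable (at x)" for i
    unfolding tensor_app_def vec_lambda_beta
    by (intro differentiable_sum finite_index_lists ballI differentiable_mult
        differentiable_const prod)
  then show ?thesis
    by (subst differentiable_componentwise_within) (auto simp: Basis_vec_def inner_axis)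
qed

text \<open>Differentiate \<open>F\<close> along \<open>t *\<^sub>R x\<close> at
  \<open>t = 1\<close> twice: by the chain rule, and from homogeneity of degree
  \<open>m - 1\<close>, where the constant \<open>b\<close> drops out.\<close>

lemma tensor_app_Euler:
  fixes A :: "'n::finite tensor"
  assumes F: "\<And>x. F x = tensor_app m A x - b"
  shows "jacobian F (at x) *v x = real (m - 1) *\<^sub>R tensor_app m A x"
proof -
  have "(jacobian F (at x) *v x) $ i = real (m - 1) * tensor_app m A x $ i" for i
  proof (rule DERIV_unique)
    have "F differentiable (at x)"
      unfolding F[abs_def] by (intro differentiable_diff tensor_app_differentiable) simp
    then show "((\<lambda>t. F (0 + t *\<^sub>R x) $ i) has_real_derivative (jacobian F (at x) *v x) $ i) (at 1)"
      using has_real_derivative_line[of F 0 1 x i] by simp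
    show "((\<lambda>t. F (0 + t *\<^sub>R x) $ i) has_real_derivative
        real (m - 1) * tensor_app m A x $ i) (at 1)"
      unfolding F by (auto simp: tensor_app_scaleR intro!: derivative_eq_intros)
  qed
  then show ?thesis by (simp add: vec_eq_iff)
qed

theorem theorem3p2:
  fixes A :: "'n::finite tensor" and b xstar :: "real ^ 'n" and m :: nat
    and F :: "real ^ 'n \<Rightarrow> real ^ 'n"
    and \<delta>1 \<delta>2 :: real and X :: "nat \<Rightarrow> real ^ 'n"
  assumes "m > 2"
    and "nonsingular_M_tensor m A"
    and "0 \<le> b"
    and "\<And>x. F x = tensor_app m A x - b"
    and "NPA_sequence F \<delta>1 \<delta>2 X"
    and "X \<longlonglongrightarrow> xstar"
  shows "F xstar = 0"
proof -
  have b: "0 \<le> b $ i" for i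
    using assms(3) by (simp add: less_eq_vec_def)
  obtain s B where "\<And>is. length is = m \<Longrightarrow> 0 \<le> B is"
    and "\<And>is. length is = m \<Longrightarrow> A is = s * id_tensor is - B is"
    using assms(2) unfolding nonsingular_M_tensor_def by blast
  then have offdiag: "A is \<le> 0" if "length is = m" "id_tensor is = 0" for "is"
    using that by simp
  interpret Z_map F
  proof
    show "F x $ i \<le> F y $ i" if "0 \<le> y" "y \<le> x" "y $ i = x $ i" for x y i
      using tensor_app_antitone[OF offdiag _ that] assms(1) by (simp add: assms(4))
    show "F differentiable (at x)" for x
      unfolding assms(4)[abs_def] by (intro differentiable_diff tensor_app_differentiable) simp
    show "F x $ i \<le> (jacobian F (at x) *v x) $ i" if "0 \<le> F x $ i" for x i
    proof -
      have "0 \<le> tensor_app m A x $ i"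
        using that b[of i] by (simp add: assms(4))
      \<comment> \<open>The factor \<open>m - 1\<close> is at least 1, and adding \<open>b\<close>
        to \<open>F x\<close> only increases it.\<close>
      then have "1 * tensor_app m A x $ i \<le> real (m - 1) * tensor_app m A x $ i"
        using assms(1) by (intro mult_right_mono) auto
      with b[of i] show ?thesis
        by (simp add: tensor_app_Euler[OF assms(4)] assms(4))
    qed
    \<comment> \<open>Homogeneity with factor 0, the exponent \<open>m - 1\<close> being
      positive.\<close>
    have "tensor_app m A 0 = 0"
      using tensor_app_scaleR[of m A 0 0] assms(1) by (simp add: power_0_left)
    with b show "F 0 \<le> 0"
      by (simp add: assms(4) less_eq_vec_def)
  qed
  show ?thesis
    using assms(5,6) by (rule NPA_sequence_limit)
qed

end
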